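(* Let $A_1,\dots,A_{m_1}$; $B_1,\dots,B_{n_1}$; $C_1,\dots,C_{n_1'}$; $D_1,\dots,D_{m_2}$; $E_1,\dots,E_{n_2}$; $F_1,\dots,F_{n_2'}$ be positive stable matrices in $\mathbb{C}^{r\times r}$ such that, for all admissible indices $p,q$, $A_pA_q=A_qA_p$, $A_pB_q=B_qA_p$, $A_pC_q=C_qA_p$, $B_pC_q=C_qB_p$, $F_pE_q=E_qF_p$, $F_qD_p=D_pF_q$, $D_pE_q=E_qD_p$, and such that $D_p+kI$, $E_p+kI$, $F_p+kI$ are invertible for all integers $k\ge 0$. Suppose that $A_i+kI$ is invertible for every $i=1,\dots,m_1$ and all integers $k\ge 0$. Let $s$ be a non-negative integer and $i\in\{1,\dots,m_1\}$. Then $$\Phi(A^{i},A_i+sI:B,C\mid D:E,F;x,y)=\Phi(A:B,C\mid D:E,F;x,y)$$ $$+\,x[A^{i}][B]\Big[\sum_{k=1}^{s}\Phi(A^{i}+I,A_i+kI:B+I,C\mid D+I:E+I,F;x,y)\Big][D]^{-1}[E]^{-1}$$ $$+\,y[A^{i}][C]\Big[\sum_{k=1}^{s}\Phi(A^{i}+I,A_i+kI:B,C+I\mid D+I:E,F+I;x,y)\Big][D]^{-1}[F]^{-1}.$$ Furthermore, if $A_i-kI$ is invertible for integers $k\le s$, then $$\Phi(A^{i},A_i-sI:B,C\mid D:E,F;x,y)=\Phi(A:B,C\mid D:E,F;x,y)$$ $$-\,x[A^{i}][B]\Big[\sum_{k=0}^{s-1}\Phi(A^{i}+I,A_i-kI:B+I,C\mid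 D+I:E+I,F;x,y)\Big][D]^{-1}[E]^{-1}$$ $$-\,y[A^{i}][C]\Big[\sum_{k=0}^{s-1}\Phi(A^{i}+I,A_i-kI:B,C+I\mid D+I:E,F+I;x,y)\Big][D]^{-1}[F]^{-1}.$$
   Context: $I$ is the $r\times r$ identity matrix. A matrix is positive stable if all its eigenvalues have positive real part. For a square matrix $P$: $(P)_0=I$, $(P)_n=P(P+I)\cdots(P+(n-1)I)$ for $n\ge1$, and $(P)_n^{-1}$ is the inverse of $(P)_n$. For lists $A=(A_1,\dots,A_{m_1})$, $B=(B_1,\dots,B_{n_1})$, $C=(C_1,\dots,C_{n_1'})$, $D=(D_1,\dots,D_{m_2})$, $E=(E_1,\dots,E_{n_2})$, $F=(F_1,\dots,F_{n_2'})$ of $r\times r$ complex matrices, the Kampé de Fériet hypergeometric matrix function is $$\Phi(A:B,C\mid D:E,F;x,y)=\sum_{m,n\ge 0}\prod_{j=1}^{m_1}(A_j)_{m+n}\prod_{j=1}^{n_1}(B_j)_m\prod_{j=1}^{n_1'}(C_j)_n\prod_{j=1}^{m_2}(D_j)^{-1}_{m+n}\prod_{j=1}^{n_2}(E_j)^{-1}_m\prod_{j=1}^{n_2'}(F_j)^{-1}_n\,\frac{x^my^n}{m!\,n!},$$ with products in the order written and, within each product, in increasing order of the index from left to right; the same formula is used for shifted parameters whenever the inverses exist. For a list $A$: $A+kI$ means adding $kI$ to every entry; $A^{i}$ is the list with $A_i$ removed; an argument $A^{i},P$ (resp. $A^{i}+kI,P$) stands for the list obtained from $A$ (resp. from $A+kI$)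 by replacing the $i$-th entry by $P$; $[A]_k=\prod_j(A_j)_k$, $[A]_k^{-1}=\prod_j(A_j)_k^{-1}$, $[A^{i}]_k=\prod_{j\ne i}(A_j)_k$, $[A^{i}]_k^{-1}=\prod_{j\neq i}(A_j)_k^{-1}$; omitted subscript means $k=1$, so $[A]=\prod_jA_j$ and $[A]^{-1}=\prod_jA_j^{-1}$. The same notation is used for the other lists. Here $x,y$ are complex numbers for which all the double series involved converge absolutely.
   Formalization: The formal statement additionally assumes that the matrices within each of the lists B, C, D, E, F commute with one another; without this the formulas fail, e.g. for A=(I), B=(diag(1,2), [[1,1],[0,1]]), E=(I,I,I), C, D, F empty, s=1, y=0, x≠0. *)

theory Defs
  imports "HOL-Analysis.Analysis"
begin

text \<open>
  Matrices in \<open>\<complex>\<^sup>r\<^sup>\<times>\<^sup>r\<close> are elements of \<open>complex ^ 'r ^ 'r\<close> with \<open>CARD('r) = r\<close>; the matrix product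
  is \<open>**\<close> and the identity is \<open>mat 1\<close> (the class operations \<open>*\<close>, \<open>1\<close>, \<open>^\<close> on this type act
  componentwise and are not used). Parameter families are lists of matrices indexed from 0.
\<close>

type_synonym 'r cmat = "complex ^ 'r ^ 'r"

definition eigenvalue :: "'r::finite cmat \<Rightarrow> complex \<Rightarrow> bool" where
  "eigenvalue P l \<longleftrightarrow> (\<exists>v. v \<noteq> 0 \<and> P *v v = l *s v)"

definition positive_stable :: "'r::finite cmat \<Rightarrow> bool" where
  "positive_stable P \<longleftrightarrow> (\<forall>l. eigenvalue P l \<longrightarrow> Re l > 0)"

definition commuting :: "'r::finite cmat list \<Rightarrow> 'r cmat list \<Rightarrow> bool" where
  "commuting Ps Qs \<longleftrightarrow> (\<forall>P \<in> set Ps. \<forall>Q \<in> set Qs. P ** Q = Q ** P)"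

text \<open>
  The recursion formulas need each list \<open>B\<close>, \<open>C\<close>, \<open>D\<close>, \<open>E\<close>, \<open>F\<close> to commute with itself as well:
  they use \<open>[B]\<^sub>m\<^sub>+\<^sub>1 = [B] [B + I]\<^sub>m\<close>, which fails for two noncommuting entries. For instance
  with \<open>r = 2\<close>, \<open>s = 1\<close>, \<open>A = (I)\<close>, \<open>B = (diag(1,2), U)\<close> where \<open>U\<close> has rows (1,1) and (0,1),
  \<open>E = (I,I,I)\<close>, \<open>C\<close>, \<open>D\<close>, \<open>F\<close> empty and \<open>y = 0\<close>, the two sides of the first formula differ by
  \<open>- x\<^sup>2 exp(x) / 2\<close> in position (1,2).
\<close>

text \<open>The HOL function \<open>pochhammer\<close> does not apply, as it would use the componentwise product.\<close>

primrec mpoch :: "'r::finite cmat \<Rightarrow> nat \<Rightarrow> 'r cmat" where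
  "mpoch P 0 = mat 1"
| "mpoch P (Suc n) = mpoch P n ** (P + mat (of_nat n))"

definition cscale :: "complex \<Rightarrow> 'r::finite cmat \<Rightarrow> 'r cmat" where
  "cscale c M = map_matrix ((*) c) M"

definition mprod :: "'r::finite cmat list \<Rightarrow> 'r cmat" where
  "mprod Ms = foldr (**) Ms (mat 1)"

text \<open>
  \<open>brk L k\<close> is \<open>[L]\<^sub>k\<close> and \<open>brk_inv L k\<close> is \<open>[L]\<^sub>k\<^sup>-\<^sup>1\<close>, the product of the inverses with the index
  increasing from left to right, which is not the inverse of \<open>brk L k\<close> when the entries do not
  commute. An omitted subscript is \<open>k = 1\<close>.
\<close>

definition brk :: "'r::finite cmat list \<Rightarrow> nat \<Rightarrow> 'r cmat" where
  "brk L k = mprod (map (\<lambda>P. mpoch P k) L)"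

definition brk_inv :: "'r::finite cmat list \<Rightarrow> nat \<Rightarrow> 'r cmat" where
  "brk_inv L k = mprod (map (\<lambda>P. matrix_inv (mpoch P k)) L)"

definition shift :: "'r::finite cmat list \<Rightarrow> nat \<Rightarrow> 'r cmat list" where
  "shift L k = map (\<lambda>P. P + mat (of_nat k)) L"

definition omit :: "nat \<Rightarrow> 'a list \<Rightarrow> 'a list" where
  "omit i L = take i L @ drop (Suc i) L"

definition Phi_term ::
  "'r::finite cmat list \<Rightarrow> 'r cmat list \<Rightarrow> 'r cmat list \<Rightarrow> 'r cmat list \<Rightarrow> 'r cmat list \<Rightarrow> 'r cmat list
   \<Rightarrow> complex \<Rightarrow> complex \<Rightarrow> nat \<times> nat \<Rightarrow> 'r cmat" where
  "Phi_term A B C D E F x y = (\<lambda>(m, n).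
     cscale (x ^ m * y ^ n / (fact m * fact n))
       (brk A (m + n) ** brk B m ** brk C n
        ** brk_inv D (m + n) ** brk_inv E m ** brk_inv F n))"

definition Phi_converges ::
  "'r::finite cmat list \<Rightarrow> 'r cmat list \<Rightarrow> 'r cmat list \<Rightarrow> 'r cmat list \<Rightarrow> 'r cmat list \<Rightarrow> 'r cmat list
   \<Rightarrow> complex \<Rightarrow> complex \<Rightarrow> bool" where
  "Phi_converges A B C D E F x y \<longleftrightarrow>
     (\<lambda>p. norm (Phi_term A B C D E F x y p)) summable_on UNIV"

text \<open>The value is only meaningful when \<open>Phi_converges\<close> holds.\<close>

definition Phi ::
  "'r::finite cmat list \<Rightarrow> 'r cmat list \<Rightarrow> 'r cmat list \<Rightarrow> 'r cmat list \<Rightarrow> 'r cmat list \<Rightarrow> 'r cmat list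
   \<Rightarrow> complex \<Rightarrow> complex \<Rightarrow> 'r cmat" where
  "Phi A B C D E F x y = infsum (Phi_term A B C D E F x y) UNIV"

end

theory Submission
  imports Defs
begin

text \<open>
  The formulas come from the telescoped contiguity relation
  \<open>(P + sI)\<^sub>N = (P)\<^sub>N + N \<Sum>\<^sub>k\<^sub>=\<^sub>1\<^sup>s (P + kI)\<^sub>N\<^sub>-\<^sub>1\<close>  (\<open>mpoch_add_Suc\<close>), applied with \<open>N = m + n\<close>
  to the \<open>i\<close>-th numerator parameter in every term of the double series. The factor \<open>m + n\<close> splits
  the increment in two: \<open>m\<close> cancels against \<open>m!\<close> and leaves \<open>x\<close> times a term of index
  \<open>(m - 1, n)\<close>, and \<open>n\<close> does the same for \<open>y\<close> and \<open>(m, n - 1)\<close>. The lists whose subscript drops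
  by one are peeled by \<open>[L]\<^sub>k\<^sub>+\<^sub>1 = [L] [L + I]\<^sub>k\<close> (\<open>brk_Suc\<close>) and its mirror image for inverses
  (\<open>brk_inv_Suc\<close>), and the commutation hypotheses carry the peeled factors to the two ends of the
  product (\<open>Phi_term_difference\<close>).

  Summing over all \<open>(m, n)\<close> gives \<open>Phi_add\<close>, in which the \<open>i\<close>-th parameter is an arbitrary matrix
  \<open>P\<close> subject to the commutation rules of \<open>A\<close>. The first formula is the case \<open>P = A\<^sub>i\<close>; the
  second is the case \<open>P = A\<^sub>i - sI\<close>, solved for \<open>\<Phi>\<close> at \<open>A\<^sub>i - sI\<close> and with \<open>k\<close> replaced by
  \<open>s - k\<close>.
\<close>

section \<open>Scalar multiples and products of matrices\<close>

lemma mat_add: "mat a + mat b = mat (a + b)" for a b :: "'a::comm_monoid_add"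
  by (simp add: vec_eq_iff mat_def)

lemma mat_commute: "M ** mat c = mat c ** M" for M :: "'r::finite cmat"
  by (simp add: vec_eq_iff matrix_matrix_mult_def mat_def if_distrib if_distribR
      sum.delta sum.delta' mult.commute cong: if_cong)

lemma mat_mult_eq_cscale: "mat c ** M = cscale c M" for M :: "'r::finite cmat"
  by (simp add: vec_eq_iff matrix_matrix_mult_def mat_def cscale_def map_matrix_def
      if_distrib if_distribR sum.delta sum.delta' cong: if_cong)

lemma cscale_mult_left: "cscale c M ** N = cscale c (M ** N)" for M N :: "'r::finite cmat"
  by (simp flip: mat_mult_eq_cscale add: matrix_mul_assoc)

lemma cscale_mult_right: "M ** cscale c N = cscale c (M ** N)" for M N :: "'r::finite cmat"
  by (metis mat_mult_eq_cscale mat_commute matrix_mul_assoc)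

lemma cscale_cscale: "cscale c (cscale d M) = cscale (c * d) M" for M :: "'r::finite cmat"
  by (simp add: vec_eq_iff cscale_def map_matrix_def)

lemma cscale_add_right: "cscale c (M + N) = cscale c M + cscale c N" for M N :: "'r::finite cmat"
  by (simp add: vec_eq_iff cscale_def map_matrix_def algebra_simps)

lemma cscale_add_left: "cscale (c + d) M = cscale c M + cscale d M" for M :: "'r::finite cmat"
  by (simp add: vec_eq_iff cscale_def map_matrix_def algebra_simps)

lemma cscale_zero_left [simp]: "cscale 0 M = 0" for M :: "'r::finite cmat"
  by (simp add: vec_eq_iff cscale_def map_matrix_def)

lemma cscale_one [simp]: "cscale 1 M = M" for M :: "'r::finite cmat"
  by (simp add: vec_eq_iff cscale_def map_matrix_def)

lemma cscale_zero_right [simp]: "cscale c (0 :: 'r::finite cmat) = 0"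
  by (simp add: vec_eq_iff cscale_def map_matrix_def)

lemma cscale_sum: "cscale c (sum f S) = (\<Sum>k\<in>S. cscale c (f k))" for f :: "'b \<Rightarrow> 'r::finite cmat"
  by (induction S rule: infinite_finite_induct) (simp_all add: cscale_add_right)

lemma matrix_add_rdistrib: "(L + M) ** N = L ** N + M ** N" for L M N :: "'r::finite cmat"
  by (simp add: vec_eq_iff matrix_matrix_mult_def sum.distrib algebra_simps)

lemma matrix_mul_sum_right: "M ** sum f S = (\<Sum>k\<in>S. M ** f k)"
  for M :: "'r::finite cmat" and f :: "'b \<Rightarrow> 'r cmat"
  by (induction S rule: infinite_finite_induct) (simp_all add: matrix_add_ldistrib)

lemma matrix_mul_sum_left: "sum f S ** M = (\<Sum>k\<in>S. f k ** M)"
  for M :: "'r::finite cmat" and f :: "'b \<Rightarrow> 'r cmat"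
  by (induction S rule: infinite_finite_induct) (simp_all add: matrix_add_rdistrib)

lemma bounded_linear_cscale_mult: "bounded_linear (\<lambda>M. cscale c (L ** M ** R))"
  for L R :: "'r::finite cmat"
proof -
  have scaleR: "a *\<^sub>R M = cscale (complex_of_real a) M" for a and M :: "'r cmat"
    unfolding vec_eq_iff cscale_def map_matrix_def
    by (simp add: scaleR_conv_of_real[where 'a = complex])
  have "linear (\<lambda>M :: 'r cmat. cscale c (L ** M ** R))"
    by (rule linearI)
      (simp_all add: scaleR cscale_mult_left cscale_mult_right cscale_cscale
        matrix_add_ldistrib matrix_add_rdistrib cscale_add_right mult.commute)
  then show ?thesis
    by (simp add: linear_conv_bounded_linear)
qed

section \<open>Commutation and invertibility\<close>

lemma commute_mult:
  fixes X Y Z :: "'r::finite cmat"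
  assumes "X ** Z = Z ** X" "Y ** Z = Z ** Y"
  shows "(X ** Y) ** Z = Z ** (X ** Y)"
  by (metis assms matrix_mul_assoc)

lemma commute_add_mat:
  fixes P Q :: "'r::finite cmat"
  assumes "P ** Q = Q ** P"
  shows "(P + mat c) ** Q = Q ** (P + mat c)"
  by (simp add: matrix_add_ldistrib matrix_add_rdistrib assms mat_commute)

lemma matrix_inv_mult_cancel:
  fixes M :: "'r::finite cmat"
  assumes "invertible M"
  shows "M ** matrix_inv M = mat 1" "matrix_inv M ** M = mat 1"
  using assms unfolding invertible_def matrix_inv_def by (metis (mono_tags, lifting) someI_ex)+

lemma matrix_inv_commute:
  fixes M Q :: "'r::finite cmat"
  assumes "invertible M" "M ** Q = Q ** M"
  shows "matrix_inv M ** Q = Q ** matrix_inv M"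
proof -
  have "matrix_inv M ** Q = matrix_inv M ** (Q ** M) ** matrix_inv M"
    by (metis assms(1) matrix_inv_mult_cancel(1) matrix_mul_assoc matrix_mul_rid)
  also have "\<dots> = Q ** matrix_inv M"
    by (metis assms matrix_inv_mult_cancel(2) matrix_mul_assoc matrix_mul_lid)
  finally show ?thesis .
qed

lemma matrix_inv_mult:
  fixes M N :: "'r::finite cmat"
  assumes "invertible M" "invertible N"
  shows "matrix_inv (M ** N) = matrix_inv N ** matrix_inv M"
proof -
  have "invertible (M ** N)"
    using assms by (rule invertible_mult)
  moreover have "M ** N ** (matrix_inv N ** matrix_inv M) = mat 1"
    by (metis assms matrix_inv_mult_cancel(1) matrix_mul_assoc matrix_mul_rid)
  ultimately show ?thesis
    by (metis matrix_inv_mult_cancel(2) matrix_mul_assoc matrix_mul_lid matrix_mul_rid)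
qed

section \<open>Matrix Pochhammer symbols\<close>

lemma mpoch_commute:
  fixes P Q :: "'r::finite cmat"
  assumes "P ** Q = Q ** P"
  shows "mpoch P n ** Q = Q ** mpoch P n"
proof (induction n)
  case (Suc n)
  then show ?case
    using commute_mult commute_add_mat[OF assms] by (metis mpoch.simps(2))
qed simp

lemma mpoch_Suc_left: "mpoch P (Suc n) = P ** mpoch (P + mat 1) n" for P :: "'r::finite cmat"
proof (induction n)
  case (Suc n)
  have "mpoch P (Suc (Suc n)) = P ** mpoch (P + mat 1) n ** (P + mat (of_nat (Suc n)))"
    using Suc by simp
  also have "P + mat (of_nat (Suc n)) = P + mat 1 + mat (of_nat n)"
    by (simp add: add.assoc mat_add)
  finally show ?case
    by (simp add: matrix_mul_assoc)
qed simp

lemma invertible_mpoch: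
  fixes P :: "'r::finite cmat"
  assumes "\<forall>k::nat. invertible (P + mat (of_nat k))"
  shows "invertible (mpoch P n)"
proof (induction n)
  case 0
  then show ?case by (simp add: invertible_def exI[of _ "mat 1"])
next
  case (Suc n)
  then show ?case using assms by (simp add: invertible_mult)
qed

text \<open>Since \<open>(P + I)\<^sub>N\<^sub>+\<^sub>1 = (P + I)\<^sub>N (P + (N + 1)I)\<close> and \<open>(P)\<^sub>N\<^sub>+\<^sub>1 = (P + I)\<^sub>N P\<close>, the difference of
  the two is a multiple of \<open>(P + I)\<^sub>N\<close>; telescoping gives the effect of a shift by \<open>s\<close>.\<close>

lemma mpoch_add_Suc:
  fixes P :: "'r::finite cmat"
  shows "mpoch (P + mat (of_nat s)) (Suc N)
    = mpoch P (Suc N) + cscale (of_nat (Suc N)) (\<Sum>k\<in>{1..s}. mpoch (P + mat (of_nat k)) N)"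
proof (induction s)
  case 0
  then show ?case by simp
next
  case (Suc s)
  define Q where "Q = P + mat (of_nat s)"
  have Q1: "P + mat (of_nat (Suc s)) = Q + mat 1"
    by (simp add: Q_def add.assoc mat_add add.commute)
  have "(Q + mat 1) + mat (of_nat N) = Q + mat (of_nat (Suc N))"
    by (simp add: add.assoc mat_add)
  then have "mpoch (Q + mat 1) (Suc N)
      = mpoch (Q + mat 1) N ** Q + mpoch (Q + mat 1) N ** mat (of_nat (Suc N))"
    by (simp only: mpoch.simps matrix_add_ldistrib)
  also have "mpoch (Q + mat 1) N ** Q = mpoch Q (Suc N)"
    unfolding mpoch_Suc_left by (intro mpoch_commute commute_add_mat refl)
  finally have "mpoch (Q + mat 1) (Suc N)
      = mpoch Q (Suc N) + cscale (of_nat (Suc N)) (mpoch (Q + mat 1) N)"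
    by (simp only: mat_commute mat_mult_eq_cscale)
  then show ?case
    using Suc unfolding Q_def[symmetric] Q1
    by (simp add: Q1[simplified] cscale_add_right del: mpoch.simps)
qed

section \<open>Bracket products of parameter lists\<close>

lemma mprod_Nil [simp]: "mprod [] = mat 1"
  and mprod_Cons [simp]: "mprod (M # Ms) = M ** mprod Ms"
  by (simp_all add: mprod_def)

lemma mprod_append: "mprod (Ms @ Ns) = mprod Ms ** mprod Ns" for Ms :: "'r::finite cmat list"
  by (induction Ms) (simp_all add: matrix_mul_assoc)

lemma mprod_commute:
  fixes Ms :: "'r::finite cmat list"
  assumes "\<And>M. M \<in> set Ms \<Longrightarrow> M ** Q = Q ** M"
  shows "mprod Ms ** Q = Q ** mprod Ms"
  using assms by (induction Ms) (simp_all add: commute_mult)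

lemma mprod_map_mult:
  fixes f g :: "'b \<Rightarrow> 'r::finite cmat"
  assumes "\<And>a b. a \<in> set L \<Longrightarrow> b \<in> set L \<Longrightarrow> f a ** g b = g b ** f a"
  shows "mprod (map (\<lambda>a. f a ** g a) L) = mprod (map f L) ** mprod (map g L)"
  using assms
proof (induction L)
  case (Cons a L)
  have "mprod (map f L) ** g a = g a ** mprod (map f L)"
    using Cons.prems by (intro mprod_commute) auto
  then have "g a ** (mprod (map f L) ** Z) = mprod (map f L) ** (g a ** Z)" for Z :: "'r cmat"
    by (simp add: matrix_mul_assoc)
  moreover have "mprod (map (\<lambda>a. f a ** g a) L) = mprod (map f L) ** mprod (map g L)"
    using Cons by simp
  ultimately show ?case
    by (simp add: matrix_mul_assoc[symmetric])
qed simp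

lemma brk_commute:
  fixes L :: "'r::finite cmat list"
  assumes "\<And>P. P \<in> set L \<Longrightarrow> P ** Q = Q ** P"
  shows "brk L k ** Q = Q ** brk L k"
  unfolding brk_def using assms by (intro mprod_commute) (auto intro: mpoch_commute)

lemma brk_inv_commute:
  fixes L :: "'r::finite cmat list"
  assumes "\<And>P. P \<in> set L \<Longrightarrow> P ** Q = Q ** P"
    and "\<forall>P \<in> set L. \<forall>k::nat. invertible (P + mat (of_nat k))"
  shows "brk_inv L k ** Q = Q ** brk_inv L k"
  unfolding brk_inv_def using assms
  by (intro mprod_commute) (auto intro!: matrix_inv_commute mpoch_commute invertible_mpoch)

lemma brk_brk_commute:
  fixes L M :: "'r::finite cmat list"
  assumes "commuting L M"
  shows "brk L j ** brk M k = brk M k ** brk L j"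
  using assms by (intro brk_commute) (metis brk_commute commuting_def)

lemma brk_inv_brk_inv_commute:
  fixes L M :: "'r::finite cmat list"
  assumes "commuting L M"
    and "\<forall>P \<in> set L. \<forall>k::nat. invertible (P + mat (of_nat k))"
    and "\<forall>P \<in> set M. \<forall>k::nat. invertible (P + mat (of_nat k))"
  shows "brk_inv L j ** brk_inv M k = brk_inv M k ** brk_inv L j"
  using assms by (intro brk_inv_commute) (metis brk_inv_commute commuting_def)+

lemma commuting_sym: "commuting L M \<Longrightarrow> commuting M L"
  by (metis commuting_def)

lemma commuting_shift: "commuting L M \<Longrightarrow> commuting (shift L k) M"
  by (auto simp: commuting_def shift_def intro: commute_add_mat)

lemma invertible_shift:
  fixes L :: "'r::finite cmat list"
  assumes "\<forall>P \<in> set L. \<forall>k::nat. invertible (P + mat (of_nat k))"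
  shows "\<forall>P \<in> set (shift L j). \<forall>k::nat. invertible (P + mat (of_nat k))"
proof -
  have "P + mat (of_nat j) + mat (of_nat k) = P + mat (of_nat (j + k))" for P :: "'r cmat" and k
    by (simp add: add.assoc mat_add)
  then have "invertible (P + mat (of_nat j) + mat (of_nat k))" if "P \<in> set L" for P k
    using assms that by metis
  then show ?thesis
    by (auto simp: shift_def)
qed

lemma brk_Suc:
  fixes L :: "'r::finite cmat list"
  assumes "commuting L L"
  shows "brk L (Suc k) = brk L 1 ** brk (shift L 1) k"
proof -
  have "brk L (Suc k) = mprod (map (\<lambda>P. P ** mpoch (P + mat 1) k) L)"
    by (simp only: brk_def mpoch_Suc_left)
  also have "\<dots> = mprod (map (\<lambda>P. P) L) ** mprod (map (\<lambda>P. mpoch (P + mat 1) k) L)"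
    using assms
    by (intro mprod_map_mult mpoch_commute[symmetric] commute_add_mat) (simp add: commuting_def)
  finally show ?thesis
    by (simp add: brk_def shift_def o_def)
qed

lemma brk_inv_Suc:
  fixes L :: "'r::finite cmat list"
  assumes "commuting L L"
    and inv: "\<forall>P \<in> set L. \<forall>k::nat. invertible (P + mat (of_nat k))"
  shows "brk_inv L (Suc k) = brk_inv (shift L 1) k ** brk_inv L 1"
proof -
  have inv0: "invertible P" if "P \<in> set L" for P
    using inv that by (metis add.right_neutral mat_0 of_nat_0)
  have inv1: "invertible (mpoch (P + mat 1) k)" if "P \<in> set L" for P
    using invertible_mpoch[of "P + mat 1" k] invertible_shift[OF inv, of 1] that
    by (simp add: shift_def)
  have "brk_inv L (Suc k)
      = mprod (map (\<lambda>P. matrix_inv (mpoch (P + mat 1) k) ** matrix_inv P) L)"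
    unfolding brk_inv_def mpoch_Suc_left
    by (intro arg_cong[where f = mprod] map_cong refl matrix_inv_mult inv0 inv1)
  also have "\<dots> = mprod (map (\<lambda>P. matrix_inv (mpoch (P + mat 1) k)) L) ** mprod (map matrix_inv L)"
    using assms
    by (intro mprod_map_mult matrix_inv_commute inv1 mpoch_commute commute_add_mat
        matrix_inv_commute[symmetric] inv0) (simp_all add: commuting_def)
  finally show ?thesis
    by (simp add: brk_inv_def shift_def o_def)
qed

lemma omit_shift: "omit i (shift L k) = shift (omit i L) k"
  by (simp add: omit_def shift_def take_map drop_map)

lemma brk_list_update:
  fixes L :: "'r::finite cmat list"
  assumes "i < length L" "\<forall>M \<in> set (omit i L). M ** P = P ** M"
  shows "brk (L[i := P]) N = brk (omit i L) N ** mpoch P N"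
proof -
  have L: "L[i := P] = take i L @ P # drop (Suc i) L"
    using assms(1) by (rule upd_conv_take_nth_drop)
  have "brk (drop (Suc i) L) N ** mpoch P N = mpoch P N ** brk (drop (Suc i) L) N"
    using assms(2) by (intro brk_commute mpoch_commute[symmetric]) (simp add: omit_def)
  then show ?thesis
    unfolding L by (simp add: brk_def omit_def mprod_append) (metis matrix_mul_assoc)
qed

lemma brk_list_update_add_Suc:
  fixes A :: "'r::finite cmat list"
  assumes i: "i < length A" and AA: "commuting A A"
    and P: "\<forall>M \<in> set A. M ** P = P ** M"
  shows "brk (A[i := P + mat (of_nat s)]) (Suc N)
    = brk (A[i := P]) (Suc N) + cscale (of_nat (Suc N))
        (brk (omit i A) 1 ** (\<Sum>k\<in>{1..s}. brk ((shift A 1)[i := P + mat (of_nat k)]) N))"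
proof -
  have Pk: "M ** (P + mat (of_nat k)) = (P + mat (of_nat k)) ** M" if "M \<in> set A" for M k
    using P that by (metis commute_add_mat)
  have omit_A: "set (omit i A) \<subseteq> set A"
    by (auto simp: omit_def dest: in_set_takeD in_set_dropD)
  have upd: "brk (A[i := P + mat (of_nat k)]) n = brk (omit i A) n ** mpoch (P + mat (of_nat k)) n"
    for k n
    using i omit_A Pk by (intro brk_list_update) auto
  have upd0: "brk (A[i := P]) n = brk (omit i A) n ** mpoch P n" for n
    using upd[of 0] by simp
  have shift_P: "M ** (P + mat (of_nat k)) = (P + mat (of_nat k)) ** M"
    if "M \<in> set (shift (omit i A) 1)" for M k
    using that omit_A Pk by (auto simp: shift_def intro!: commute_add_mat)
  have upd1: "brk ((shift A 1)[i := P + mat (of_nat k)]) n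
      = brk (shift (omit i A) 1) n ** mpoch (P + mat (of_nat k)) n" for k n
  proof -
    have "i < length (shift A 1)"
      using i by (simp add: shift_def)
    from brk_list_update[OF this, unfolded omit_shift] show ?thesis
      using shift_P by blast
  qed
  have omit_omit: "commuting (omit i A) (omit i A)"
    using AA omit_A by (auto simp: commuting_def)
  show ?thesis
    unfolding upd upd0 upd1 mpoch_add_Suc brk_Suc[OF omit_omit]
    by (simp only: matrix_add_ldistrib cscale_mult_right matrix_mul_sum_right matrix_mul_assoc)
qed

section \<open>The terms of the series\<close>

text \<open>Below, \<open>X\<close> and \<open>Y\<close> are the \<open>p\<close>-th terms of the two correction series. At the index
  \<open>(m, n)\<close> they enter with the first, respectively second, index lowered by one; the guards
  exclude the boundary, where the factor \<open>m\<close> or \<open>n\<close> vanishes.\<close>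

lemma Phi_term_difference:
  fixes A B C D E F :: "'r::finite cmat list" and x y :: complex and s m n :: nat
  assumes i: "i < length A" and AA: "commuting A A" and AB: "commuting A B" and AC: "commuting A C"
    and BC: "commuting B C" and FE: "commuting F E" and FD: "commuting F D" and DE: "commuting D E"
    and BB: "commuting B B" and CC: "commuting C C"
    and DD: "commuting D D" and EE: "commuting E E" and FF: "commuting F F"
    and invD: "\<forall>P \<in> set D. \<forall>k::nat. invertible (P + mat (of_nat k))"
    and invE: "\<forall>P \<in> set E. \<forall>k::nat. invertible (P + mat (of_nat k))"
    and invF: "\<forall>P \<in> set F. \<forall>k::nat. invertible (P + mat (of_nat k))"
    and P: "\<forall>M \<in> set (A @ B @ C). M ** P = P ** M"
  defines "X \<equiv> \<lambda>p. cscale x (brk (omit i A) 1 ** brk B 1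
            ** (\<Sum>k\<in>{1..s}. Phi_term ((shift A 1)[i := P + mat (of_nat k)])
                  (shift B 1) C (shift D 1) (shift E 1) F x y p)
            ** brk_inv D 1 ** brk_inv E 1)"
    and "Y \<equiv> \<lambda>p. cscale y (brk (omit i A) 1 ** brk C 1
            ** (\<Sum>k\<in>{1..s}. Phi_term ((shift A 1)[i := P + mat (of_nat k)])
                  B (shift C 1) (shift D 1) E (shift F 1) x y p)
            ** brk_inv D 1 ** brk_inv F 1)"
  shows "Phi_term (A[i := P + mat (of_nat s)]) B C D E F x y (m, n)
    = Phi_term (A[i := P]) B C D E F x y (m, n)
      + (if m = 0 then 0 else X (m - 1, n)) + (if n = 0 then 0 else Y (m, n - 1))"
proof -
  define G where "G = brk (omit i A) 1"
  define S where "S N = (\<Sum>k\<in>{1..s}. brk ((shift A 1)[i := P + mat (of_nat k)]) N)" for N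
  define W :: "'r cmat \<Rightarrow> 'r cmat" where "W M = M ** brk B m ** brk C n
        ** brk_inv D (m + n) ** brk_inv E m ** brk_inv F n" for M
  define c where "c = x ^ m * y ^ n / (fact m * fact n)"
  have W_add: "W (M + M') = W M + W M'" and W_cscale: "W (cscale a M) = cscale a (W M)"
    for M M' :: "'r cmat" and a
    by (simp_all only: W_def matrix_add_rdistrib cscale_mult_left)
  have Phi_term_W: "Phi_term (A[i := Q]) B C D E F x y (m, n) = cscale c (W (brk (A[i := Q]) (m + n)))"
    for Q
    by (simp add: Phi_term_def c_def W_def)
  have S_commute: "S N ** Q = Q ** S N"
    if "commuting A [Q]" "P ** Q = Q ** P" for N Q
  proof -
    have "commuting ((shift A 1)[i := P + mat (of_nat k)]) [Q]" for k
      using commuting_shift[OF that(1), of 1] commute_add_mat[OF that(2)]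
      by (auto simp: commuting_def dest!: set_update_subset_insert[THEN subsetD])
    then have "brk ((shift A 1)[i := P + mat (of_nat k)]) N ** Q
        = Q ** brk ((shift A 1)[i := P + mat (of_nat k)]) N" for k
      by (intro brk_commute) (simp add: commuting_def)
    then show ?thesis
      by (simp add: S_def matrix_mul_sum_left matrix_mul_sum_right)
  qed
  have S_B: "S N ** brk B 1 = brk B 1 ** S N" for N
    using AB P by (intro S_commute)
      (auto simp: commuting_def intro!: brk_commute brk_commute[symmetric])
  have S_C: "S N ** brk C 1 = brk C 1 ** S N" for N
    using AC P by (intro S_commute)
      (auto simp: commuting_def intro!: brk_commute brk_commute[symmetric])
  \<comment> \<open>The factors \<open>[B]\<close> and \<open>[D]\<^sup>-\<^sup>1\<close>, \<open>[E]\<^sup>-\<^sup>1\<close> are peeled off and moved outwards.\<close>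
  have X_part: "cscale (c * of_nat m) (W (G ** S (m + n - 1))) = (if m = 0 then 0 else X (m - 1, n))"
  proof (cases m)
    case (Suc m')
    define B1 Bs C0 D1 Ds E1 Es F0 where defs:
      "B1 = brk B 1" "Bs = brk (shift B 1) m'" "C0 = brk C n"
      "D1 = brk_inv D 1" "Ds = brk_inv (shift D 1) (m' + n)"
      "E1 = brk_inv E 1" "Es = brk_inv (shift E 1) m'" "F0 = brk_inv F n"
    have DEs: "D1 ** Es = Es ** D1"
      unfolding defs using DE commuting_sym commuting_shift invertible_shift invD invE
      by (intro brk_inv_brk_inv_commute) blast+
    have DF: "D1 ** F0 = F0 ** D1"
      unfolding defs using FD commuting_sym invD invF by (intro brk_inv_brk_inv_commute) blast+
    have EF: "E1 ** F0 = F0 ** E1"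
      unfolding defs using FE commuting_sym invE invF by (intro brk_inv_brk_inv_commute) blast+
    have SB: "S N ** (B1 ** Z) = B1 ** (S N ** Z)" for N and Z :: "'r cmat"
      using S_B unfolding defs by (metis matrix_mul_assoc)
    have D_left: "D1 ** (Es ** Z) = Es ** (D1 ** Z)" "D1 ** (F0 ** Z) = F0 ** (D1 ** Z)"
      for Z :: "'r cmat"
      using DEs DF by (metis matrix_mul_assoc)+
    have "W (G ** S (m + n - 1))
        = G ** S (m' + n) ** (B1 ** Bs) ** C0 ** (Ds ** D1) ** (Es ** E1) ** F0"
      unfolding W_def defs Suc add_Suc diff_Suc_1
        brk_Suc[OF BB] brk_inv_Suc[OF DD invD] brk_inv_Suc[OF EE invE] ..
    also have "\<dots> = G ** B1 ** (S (m' + n) ** Bs ** C0 ** Ds ** Es ** F0) ** D1 ** E1"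
      by (simp only: matrix_mul_assoc[symmetric] SB D_left EF)
    finally have W_eq: "W (G ** S (m + n - 1))
        = G ** B1 ** (S (m' + n) ** Bs ** C0 ** Ds ** Es ** F0) ** D1 ** E1" .
    have "X (m', n) = cscale x (G ** B1 ** cscale (x ^ m' * y ^ n / (fact m' * fact n))
        (S (m' + n) ** Bs ** C0 ** Ds ** Es ** F0) ** D1 ** E1)"
      by (simp add: X_def G_def S_def Phi_term_def defs cscale_sum matrix_mul_sum_left)
    moreover have "c * of_nat m = x * (x ^ m' * y ^ n / (fact m' * fact n))"
      by (simp add: c_def Suc divide_simps del: of_nat_Suc)
    ultimately show ?thesis
      by (simp only: W_eq cscale_mult_left cscale_mult_right cscale_cscale) (simp add: Suc)
  qed simp
  \<comment> \<open>Here \<open>[C]\<close> moreover has to pass \<open>[B]\<^sub>m\<close>, and \<open>[D]\<^sup>-\<^sup>1\<close> the factors of \<open>E\<close> and \<open>F\<close>.\<close>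
  have Y_part: "cscale (c * of_nat n) (W (G ** S (m + n - 1))) = (if n = 0 then 0 else Y (m, n - 1))"
  proof (cases n)
    case (Suc n')
    define B0 C1 Cs D1 Ds E0 F1 Fs where defs:
      "B0 = brk B m" "C1 = brk C 1" "Cs = brk (shift C 1) n'"
      "D1 = brk_inv D 1" "Ds = brk_inv (shift D 1) (m + n')"
      "E0 = brk_inv E m" "F1 = brk_inv F 1" "Fs = brk_inv (shift F 1) n'"
    have DE0: "D1 ** E0 = E0 ** D1"
      unfolding defs using DE invD invE by (intro brk_inv_brk_inv_commute)
    have DFs: "D1 ** Fs = Fs ** D1"
      unfolding defs using FD commuting_sym commuting_shift invertible_shift invD invF
      by (intro brk_inv_brk_inv_commute) blast+
    have BC1: "B0 ** C1 = C1 ** B0"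
      unfolding defs using BC by (intro brk_brk_commute)
    have SC: "S N ** (C1 ** Z) = C1 ** (S N ** Z)" for N and Z :: "'r cmat"
      using S_C unfolding defs by (metis matrix_mul_assoc)
    have B_left: "B0 ** (C1 ** Z) = C1 ** (B0 ** Z)" for Z :: "'r cmat"
      using BC1 by (metis matrix_mul_assoc)
    have D_left: "D1 ** (E0 ** Z) = E0 ** (D1 ** Z)" "D1 ** (Fs ** Z) = Fs ** (D1 ** Z)"
      for Z :: "'r cmat"
      using DE0 DFs by (metis matrix_mul_assoc)+
    have "W (G ** S (m + n - 1))
        = G ** S (m + n') ** B0 ** (C1 ** Cs) ** (Ds ** D1) ** E0 ** (Fs ** F1)"
      unfolding W_def defs Suc add_Suc_right diff_Suc_1
        brk_Suc[OF CC] brk_inv_Suc[OF DD invD] brk_inv_Suc[OF FF invF] ..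
    also have "\<dots> = G ** C1 ** (S (m + n') ** B0 ** Cs ** Ds ** E0 ** Fs) ** D1 ** F1"
      by (simp only: matrix_mul_assoc[symmetric] SC B_left D_left)
    finally have W_eq: "W (G ** S (m + n - 1))
        = G ** C1 ** (S (m + n') ** B0 ** Cs ** Ds ** E0 ** Fs) ** D1 ** F1" .
    have "Y (m, n') = cscale y (G ** C1 ** cscale (x ^ m * y ^ n' / (fact m * fact n'))
        (S (m + n') ** B0 ** Cs ** Ds ** E0 ** Fs) ** D1 ** F1)"
      by (simp add: Y_def G_def S_def Phi_term_def defs cscale_sum matrix_mul_sum_left)
    moreover have "c * of_nat n = y * (x ^ m * y ^ n' / (fact m * fact n'))"
      by (simp add: c_def Suc divide_simps del: of_nat_Suc)
    ultimately show ?thesis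
      by (simp only: W_eq cscale_mult_left cscale_mult_right cscale_cscale) (simp add: Suc)
  qed simp
  have A_part: "brk (A[i := P + mat (of_nat s)]) (m + n)
      = brk (A[i := P]) (m + n) + cscale (of_nat (m + n)) (G ** S (m + n - 1))"
  proof (cases "m + n")
    \<comment> \<open>Both symbols of order 0 are the identity, and the factor \<open>m + n\<close> removes the sum.\<close>
    case 0
    have "brk L 0 = mat 1" for L :: "'r cmat list"
      by (induction L) (simp_all add: brk_def)
    then show ?thesis
      by (simp add: 0)
  next
    case (Suc N)
    then show ?thesis
      using brk_list_update_add_Suc[OF i AA, of P s N] P by (simp only: G_def S_def) simp
  qed
  show ?thesis
    unfolding Phi_term_W X_part[symmetric] Y_part[symmetric] A_part W_add W_cscale cscale_add_right
    by (simp add: cscale_cscale cscale_add_left cscale_add_right add.assoc)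
qed

section \<open>Summation\<close>

lemma has_sum_shift_fst:
  fixes f :: "nat \<times> nat \<Rightarrow> 'a::{comm_monoid_add, topological_space}"
  assumes "(f has_sum S) UNIV"
  shows "((\<lambda>(m, n). if m = 0 then 0 else f (m - 1, n)) has_sum S) UNIV"
proof -
  let ?g = "\<lambda>(m, n). if m = 0 then 0 else f (m - 1, n)"
  have "(?g \<circ> map_prod Suc id has_sum S) UNIV"
    using assms by (simp add: o_def case_prod_beta)
  then have "(?g has_sum S) (range (map_prod Suc id))"
    by (subst has_sum_reindex) (auto simp: prod.inj_map)
  also have "?this \<longleftrightarrow> (?g has_sum S) UNIV"
    by (rule has_sum_cong_neutral) (auto simp: image_iff gr0_conv_Suc)
  finally show ?thesis .
qed

lemma has_sum_shift_snd:
  fixes f :: "nat \<times> nat \<Rightarrow> 'a::{comm_monoid_add, topological_space}"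
  assumes "(f has_sum S) UNIV"
  shows "((\<lambda>(m, n). if n = 0 then 0 else f (m, n - 1)) has_sum S) UNIV"
proof -
  let ?g = "\<lambda>(m, n). if n = 0 then 0 else f (m, n - 1)"
  have "(?g \<circ> map_prod id Suc has_sum S) UNIV"
    using assms by (simp add: o_def case_prod_beta)
  then have "(?g has_sum S) (range (map_prod id Suc))"
    by (subst has_sum_reindex) (auto simp: prod.inj_map)
  also have "?this \<longleftrightarrow> (?g has_sum S) UNIV"
    by (rule has_sum_cong_neutral) (auto simp: image_iff gr0_conv_Suc)
  finally show ?thesis .
qed

lemma has_sum_finite_sum:
  fixes f :: "'b \<Rightarrow> 'c \<Rightarrow> 'a::topological_comm_monoid_add"
  assumes "\<And>k. k \<in> K \<Longrightarrow> (f k has_sum S k) UNIV"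
  shows "((\<lambda>p. \<Sum>k\<in>K. f k p) has_sum (\<Sum>k\<in>K. S k)) UNIV"
  using assms
  by (induction K rule: infinite_finite_induct) (auto intro!: has_sum_add simp: has_sum_0)

lemma Phi_has_sum:
  "Phi_converges A B C D E F x y \<Longrightarrow>
    (Phi_term A B C D E F x y has_sum Phi A B C D E F x y) UNIV"
  unfolding Phi_converges_def Phi_def
  by (rule has_sum_infsum, rule abs_summable_summable)

text \<open>The sum over \<open>k\<close> is taken inside each term, so the series with \<open>i\<close>-th parameter
  \<open>P + kI\<close>, \<open>0 < k < s\<close>, and the other parameters unshifted do not enter, and their convergence is
  not needed.\<close>

lemma Phi_add:
  fixes A B C D E F :: "'r::finite cmat list"
  assumes i: "i < length A" and AA: "commuting A A" and AB: "commuting A B" and AC: "commuting A C"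
    and BC: "commuting B C" and FE: "commuting F E" and FD: "commuting F D" and DE: "commuting D E"
    and BB: "commuting B B" and CC: "commuting C C"
    and DD: "commuting D D" and EE: "commuting E E" and FF: "commuting F F"
    and invD: "\<forall>P \<in> set D. \<forall>k::nat. invertible (P + mat (of_nat k))"
    and invE: "\<forall>P \<in> set E. \<forall>k::nat. invertible (P + mat (of_nat k))"
    and invF: "\<forall>P \<in> set F. \<forall>k::nat. invertible (P + mat (of_nat k))"
    and P: "\<forall>M \<in> set (A @ B @ C). M ** P = P ** M"
    and conv: "Phi_converges (A[i := P]) B C D E F x y"
    and conv_s: "Phi_converges (A[i := P + mat (of_nat s)]) B C D E F x y"
    and conv_x: "\<And>k. k \<in> {1..s} \<Longrightarrow> Phi_converges ((shift A 1)[i := P + mat (of_nat k)])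
            (shift B 1) C (shift D 1) (shift E 1) F x y"
    and conv_y: "\<And>k. k \<in> {1..s} \<Longrightarrow> Phi_converges ((shift A 1)[i := P + mat (of_nat k)])
            B (shift C 1) (shift D 1) E (shift F 1) x y"
  shows "Phi (A[i := P + mat (of_nat s)]) B C D E F x y
      = Phi (A[i := P]) B C D E F x y
        + cscale x (brk (omit i A) 1 ** brk B 1
            ** (\<Sum>k\<in>{1..s}. Phi ((shift A 1)[i := P + mat (of_nat k)])
                  (shift B 1) C (shift D 1) (shift E 1) F x y)
            ** brk_inv D 1 ** brk_inv E 1)
        + cscale y (brk (omit i A) 1 ** brk C 1
            ** (\<Sum>k\<in>{1..s}. Phi ((shift A 1)[i := P + mat (of_nat k)])
                  B (shift C 1) (shift D 1) E (shift F 1) x y)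
            ** brk_inv D 1 ** brk_inv F 1)"
    (is "_ = _ + ?X + ?Y")
proof -
  define X where "X = (\<lambda>p. cscale x (brk (omit i A) 1 ** brk B 1
            ** (\<Sum>k\<in>{1..s}. Phi_term ((shift A 1)[i := P + mat (of_nat k)])
                  (shift B 1) C (shift D 1) (shift E 1) F x y p)
            ** brk_inv D 1 ** brk_inv E 1))"
  define Y where "Y = (\<lambda>p. cscale y (brk (omit i A) 1 ** brk C 1
            ** (\<Sum>k\<in>{1..s}. Phi_term ((shift A 1)[i := P + mat (of_nat k)])
                  B (shift C 1) (shift D 1) E (shift F 1) x y p)
            ** brk_inv D 1 ** brk_inv F 1))"
  have X: "(X has_sum ?X) UNIV"
    using has_sum_bounded_linear[OF bounded_linear_cscale_mult[where c = x
          and L = "brk (omit i A) 1 ** brk B 1" and R = "brk_inv D 1 ** brk_inv E 1"]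
        has_sum_finite_sum[where K = "{1..s}"
          and f = "\<lambda>k. Phi_term ((shift A 1)[i := P + mat (of_nat k)])
            (shift B 1) C (shift D 1) (shift E 1) F x y", OF Phi_has_sum[OF conv_x]]]
    by (simp add: X_def matrix_mul_assoc o_def)
  have Y: "(Y has_sum ?Y) UNIV"
    using has_sum_bounded_linear[OF bounded_linear_cscale_mult[where c = y
          and L = "brk (omit i A) 1 ** brk C 1" and R = "brk_inv D 1 ** brk_inv F 1"]
        has_sum_finite_sum[where K = "{1..s}"
          and f = "\<lambda>k. Phi_term ((shift A 1)[i := P + mat (of_nat k)])
            B (shift C 1) (shift D 1) E (shift F 1) x y", OF Phi_has_sum[OF conv_y]]]
    by (simp add: Y_def matrix_mul_assoc o_def)
  have "((\<lambda>p. Phi_term (A[i := P]) B C D E F x y p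
        + (case p of (m, n) \<Rightarrow> if m = 0 then 0 else X (m - 1, n))
        + (case p of (m, n) \<Rightarrow> if n = 0 then 0 else Y (m, n - 1)))
      has_sum (Phi (A[i := P]) B C D E F x y + ?X + ?Y)) UNIV"
    by (intro has_sum_add Phi_has_sum conv has_sum_shift_fst has_sum_shift_snd X Y)
  also have "(\<lambda>p. Phi_term (A[i := P]) B C D E F x y p
        + (case p of (m, n) \<Rightarrow> if m = 0 then 0 else X (m - 1, n))
        + (case p of (m, n) \<Rightarrow> if n = 0 then 0 else Y (m, n - 1)))
      = Phi_term (A[i := P + mat (of_nat s)]) B C D E F x y"
    unfolding X_def Y_def
    by (intro ext, clarsimp simp only: prod.case
        Phi_term_difference[OF i AA AB AC BC FE FD DE BB CC DD EE FF invD invE invF P])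
  finally show ?thesis
    using Phi_has_sum[OF conv_s] has_sum_unique by blast
qed

section \<open>The recursion formulas\<close>

theorem theorem2p1:
  fixes A B C D E F :: "(complex ^ 'r::finite ^ 'r) list"
    and x y :: complex and s i :: nat
  assumes i: "i < length A"
    and stable: "\<forall>P \<in> set (A @ B @ C @ D @ E @ F). positive_stable P"
    and AA: "commuting A A" and AB: "commuting A B" and AC: "commuting A C"
    and BC: "commuting B C"
    and FE: "commuting F E" and FD: "commuting F D" and DE: "commuting D E"
    and BB: "commuting B B" and CC: "commuting C C"
    and DD: "commuting D D" and EE: "commuting E E" and FF: "commuting F F"
    and invDEF: "\<forall>P \<in> set (D @ E @ F). \<forall>k::nat. invertible (P + mat (of_nat k))"
    and invA: "\<forall>P \<in> set A. \<forall>k::nat. invertible (P + mat (of_nat k))"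
  shows
    "(Phi_converges A B C D E F x y
      \<and> Phi_converges (A[i := A ! i + mat (of_nat s)]) B C D E F x y
      \<and> (\<forall>k \<in> {1..s}.
          Phi_converges ((shift A 1)[i := A ! i + mat (of_nat k)])
            (shift B 1) C (shift D 1) (shift E 1) F x y
          \<and> Phi_converges ((shift A 1)[i := A ! i + mat (of_nat k)])
            B (shift C 1) (shift D 1) E (shift F 1) x y)
      \<longrightarrow>
      Phi (A[i := A ! i + mat (of_nat s)]) B C D E F x y
      = Phi A B C D E F x y
        + cscale x (brk (omit i A) 1 ** brk B 1
            ** (\<Sum>k\<in>{1..s}. Phi ((shift A 1)[i := A ! i + mat (of_nat k)])
                  (shift B 1) C (shift D 1) (shift E 1) F x y)
            ** brk_inv D 1 ** brk_inv E 1)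
        + cscale y (brk (omit i A) 1 ** brk C 1
            ** (\<Sum>k\<in>{1..s}. Phi ((shift A 1)[i := A ! i + mat (of_nat k)])
                  B (shift C 1) (shift D 1) E (shift F 1) x y)
            ** brk_inv D 1 ** brk_inv F 1))
     \<and>
     ((\<forall>k::int. k \<le> int s \<longrightarrow> invertible (A ! i - mat (of_int k)))
      \<and> Phi_converges A B C D E F x y
      \<and> Phi_converges (A[i := A ! i - mat (of_nat s)]) B C D E F x y
      \<and> (\<forall>k \<in> {0..<s}.
          Phi_converges ((shift A 1)[i := A ! i - mat (of_nat k)])
            (shift B 1) C (shift D 1) (shift E 1) F x y
          \<and> Phi_converges ((shift A 1)[i := A ! i - mat (of_nat k)])
            B (shift C 1) (shift D 1) E (shift F 1) x y)
      \<longrightarrow>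
      Phi (A[i := A ! i - mat (of_nat s)]) B C D E F x y
      = Phi A B C D E F x y
        - cscale x (brk (omit i A) 1 ** brk B 1
            ** (\<Sum>k\<in>{0..<s}. Phi ((shift A 1)[i := A ! i - mat (of_nat k)])
                  (shift B 1) C (shift D 1) (shift E 1) F x y)
            ** brk_inv D 1 ** brk_inv E 1)
        - cscale y (brk (omit i A) 1 ** brk C 1
            ** (\<Sum>k\<in>{0..<s}. Phi ((shift A 1)[i := A ! i - mat (of_nat k)])
                  B (shift C 1) (shift D 1) E (shift F 1) x y)
            ** brk_inv D 1 ** brk_inv F 1))"
proof -
  have invD: "\<forall>P \<in> set D. \<forall>k::nat. invertible (P + mat (of_nat k))"
    and invE: "\<forall>P \<in> set E. \<forall>k::nat. invertible (P + mat (of_nat k))"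
    and invF: "\<forall>P \<in> set F. \<forall>k::nat. invertible (P + mat (of_nat k))"
    using invDEF by auto
  note add = Phi_add[OF i AA AB AC BC FE FD DE BB CC DD EE FF invD invE invF]
  have Ai: "\<forall>M \<in> set (A @ B @ C). M ** A ! i = A ! i ** M"
    using AA AB AC nth_mem[OF i] by (auto simp: commuting_def)
  define Q where "Q = A ! i - mat (of_nat s)"
  have "Q = A ! i + mat (- of_nat s)"
    by (simp add: Q_def mat_def vec_eq_iff)
  then have "M ** Q = Q ** M" if "M ** A ! i = A ! i ** M" for M
    using commute_add_mat that by metis
  then have Q: "\<forall>M \<in> set (A @ B @ C). M ** Q = Q ** M"
    using Ai by blast
  have Q_s: "Q + mat (of_nat s) = A ! i"
    by (simp add: Q_def)
  have Q_k: "Q + mat (of_nat k) = A ! i - mat (of_nat (s - k))" if "k \<le> s" for k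
  proof -
    have "(mat (of_nat s) :: 'r cmat) = mat (of_nat k) + mat (of_nat (s - k))"
      using that by (simp add: mat_add flip: of_nat_add)
    then show ?thesis
      by (simp only: Q_def) simp
  qed
  have reverse: "(\<Sum>k\<in>{1..s}. f (Q + mat (of_nat k)))
      = (\<Sum>k\<in>{0..<s}. f (A ! i - mat (of_nat k)))"
    for f :: "'r cmat \<Rightarrow> 'r cmat"
    by (rule sum.reindex_bij_witness[of _ "\<lambda>k. s - k" "\<lambda>k. s - k"]) (auto simp: Q_k)
  note reverse_x = reverse[of
      "\<lambda>P. Phi ((shift A 1)[i := P])
      (shift B 1) C (shift D 1) (shift E 1) F x y"]
  note reverse_y = reverse[of
      "\<lambda>P. Phi ((shift A 1)[i := P])
      B (shift C 1) (shift D 1) E (shift F 1) x y"]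
  show ?thesis
  proof (intro conjI impI, goal_cases)
    case 1
    then show ?case
      using add[OF Ai, where s = s and x = x and y = y] by simp
  next
    case 2
    have "Phi_converges ((shift A 1)[i := Q + mat (of_nat k)])
            (shift B 1) C (shift D 1) (shift E 1) F x y
          \<and> Phi_converges ((shift A 1)[i := Q + mat (of_nat k)])
            B (shift C 1) (shift D 1) E (shift F 1) x y" if "k \<in> {1..s}" for k
    proof -
      have "k \<le> s" "s - k \<in> {0..<s}"
        using that by auto
      then show ?thesis
        using 2 by (simp only: Q_k)
    qed
    then show ?case
      using 2 add[OF Q, where s = s and x = x and y = y]
      by (simp only: Q_s reverse_x reverse_y list_update_id Q_def[symmetric]) simp
  qed
qed

end
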